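(* Let the market data, the constants $\bar\pi, M_j, M_c$, the set UMFS, and, for partitions $J=J_r\cup J_a$ and $C=C_r\cup C_a$, the Primal, Dual and Complementarity conditions be as defined in the context. Say that a point satisfies the price range condition if $\pi_{l,t}\in[-\bar\pi,\bar\pi]$ for all locations $l$ and time slots $t$. (I) Let $(x,y,u,n,\pi,v,s,d^a,d^r,du^a,du^r)$ be any point of UMFS satisfying the price range condition, and define $J_r=\{j\in J: y_j=0\}$, $J_a=\{j\in J: y_j=1\}$, $C_r=\{c\in C: u_c=0\}$, $C_a=\{c\in C: u_c=1\}$. Then the projection $$(x,y,u,n,\pi,v,s,(d^a_{j})_{j\in J_a},(d^r_{j})_{j\in J_r},(du^a_{c})_{c\in C_a},(du^r_{c})_{c\in C_r})$$ satisfies all the Primal, Dual and Complementarity conditions associated with the partitions $J=J_r\cup J_a$, $C=C_r\cup C_a$. (II) Conversely, let $J=J_r\cup J_a$ and $C=C_r\cup C_a$ be arbitrary partitions, and let $$(x,y,u,n,\pi,v,s,(d^a_{j})_{j\in J_a},(d^r_{j})_{j\in J_r},(du^a_{c})_{c\in C_a},(du^r_{c})_{c\in C_r})$$ be any point satisfying all the Primal, Dual and Complementarity conditions associated with these partitions, and satisfying the price range condition. Then it can be lifted to a point of UMFS: there exist $\tilde s$, $\tilde d^a=(\tilde d^a_j)_{j\in J}$, $\tilde d^r=(\tilde d^r_j)_{j\in J}$, $\tilde{du}^a=(\tilde{du}^a_c)_{c\in C}$, $\tilde{du}^r=(\tilde{du}^r_c)_{c\in C}$ such that $$(x,y,u,n,\pi,v,\tilde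 s,\tilde d^a,\tilde d^r,\tilde{du}^a,\tilde{du}^r)$$ belongs to UMFS.
   Context: **Data.** All index sets are finite. $I$ is the set of hourly bids $i$, $J$ the set of block bids $j$, $C$ the set of MIC bids $c$; each $c\in C$ has a set $H_c$ of hourly suborders, a suborder $h\in H_c$ being denoted $hc$. Locations are indexed by $l$, time slots by $t$. Each hourly bid $i$ (resp. suborder $hc$) has a location $l(i)$ (resp. $l(hc)$) and a time slot $t(i)$ (resp. $t(hc)$); each block bid $j$ has a location $l(j)$. $I_{lt}$ (resp. $HC_{lt}$) is the set of hourly bids (resp. of suborders of all MIC bids) with location $l$ and time slot $t$; $J_l$ is the set of block bids at location $l$. Real parameters: powers $P_i$, $P_{hc}$, $P^t_j$ (negative for sell, positive for buy), limit prices $\lambda^i,\lambda^{hc},\lambda^j$, network parameters $a_{m,k}$, $e^k_{l,t}$, $w_m$ ($m\in N$, $k\in K$). Write $P_j\lambda^j:=\sum_t P^t_j\lambda^j$. **Price bound and big-M constants.** $\bar\pi>0$ is a fixed real number such that all limit prices $\lambda^i,\lambda^{hc},\lambda^j$ lie in $[-\bar\pi,\bar\pi]$. $M_j$ ($j\in J$) and $M_c$ ($c\in C$) are fixed constants with $M_j\ge 2\bar\pi\sum_t|P^t_j|$ and $M_c\ge 2\bar\pi\sum_{h\in H_c}|P_{hc}|$. **Variables.** $x=((x_i)_{i\in I},(x_{hc})_{h\in H_c,c\in C})$, $y=(y_j)_{j\in J}$, $u=(u_c)_{c\in C}$, $n=(n_k)_{k\in K}$, $\pi=(\pi_{l,t})$,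 $v=(v_m)_{m\in N}$, $s=((s_i),(s_j),(s_{hc}),(s_c))$, and $d^a,d^r$ (indexed by block bids), $du^a,du^r$ (indexed by MIC bids). All are real; $n$ and $\pi$ are free in sign. **Primal conditions** (for partitions $J=J_r\cup J_a$, $C=C_r\cup C_a$): - $x_i\le1$ for $i\in I$; $y_j\le 1$ for $j\in J$; $x_{hc}\le u_c$ for $h\in H_c,c\in C$; $u_c\le1$ for $c\in C$; - $\sum_{i\in I_{lt}}P_ix_i+\sum_{j\in J_l}P^t_jy_j+\sum_{hc\in HC_{lt}}P_{hc}x_{hc}=\sum_k e^k_{l,t}n_k$ for all $(l,t)$; - $\sum_k a_{m,k}n_k\le w_m$ for $m\in N$; - $x,y,u\ge0$; $y,u$ integer; - $-y_j\le-1$ for $j\in J_a$; $y_j\le0$ for $j\in J_r$; $-u_c\le-1$ for $c\in C_a$; $u_c\le 0$ for $c\in C_r$. **Dual conditions** (for the same partitions; variables $d^a_j$ for $j\in J_a$, $d^r_j$ for $j\in J_r$, $du^a_c$ for $c\in C_a$, $du^r_c$ for $c\in C_r$): - $s_i+P_i\pi_{l(i),t(i)}\ge P_i\lambda^i$ for $i\in I$; - $s_{hc}+P_{hc}\pi_{l(hc),t(hc)}\ge P_{hc}\lambda^{hc}$ for $h\in H_c$, $c\in C$; - $s_j+d^r_j+\sum_tP^t_j\pi_{l(j),t}\ge P_j\lambda^j$ for $j\in J_r$; - $s_j-d^a_j+\sum_tP^t_j\pi_{l(j),t}\ge P_j\lambda^j$ for $j\in J_a$; - $s_c+du^r_c\ge\sum_{h\in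 H_c}s_{hc}$ for $c\in C_r$; $s_c-du^a_c\ge\sum_{h\in H_c}s_{hc}$ for $c\in C_a$; - $\sum_m a_{m,k}v_m-\sum_{l,t}e^k_{l,t}\pi_{l,t}=0$ for $k\in K$; - $s_i,s_j,s_c,s_{hc},d^r_j,d^a_j,du^r_c,du^a_c,v_m\ge0$. **Complementarity conditions** (for the same partitions): - $s_i(1-x_i)=0$ for $i\in I$; $s_j(1-y_j)=0$ for $j\in J$; $s_{hc}(u_c-x_{hc})=0$ for $h\in H_c,c\in C$; $s_c(1-u_c)=0$ for $c\in C$; - $v_m(\sum_ka_{m,k}n_k-w_m)=0$ for $m\in N$; - $(1-y_j)d^a_j=0$ for $j\in J_a$; $y_jd^r_j=0$ for $j\in J_r$; $(1-u_c)du^a_c=0$ for $c\in C_a$; $u_cdu^r_c=0$ for $c\in C_r$; - $x_i(s_i+P_i\pi_{l(i),t(i)}-P_i\lambda^i)=0$ for $i\in I$; $x_{hc}(s_{hc}+P_{hc}\pi_{l(hc),t(hc)}-P_{hc}\lambda^{hc})=0$ for $h\in H_c,c\in C$; - $y_j(s_j+d^r_j+\sum_tP^t_j(\pi_{l(j),t}-\lambda^j))=0$ for $j\in J_r$; $y_j(s_j-d^a_j+\sum_tP^t_j(\pi_{l(j),t}-\lambda^j))=0$ for $j\in J_a$; - $u_c(s_c+du^r_c-\sum_{h\in H_c}s_{hc})=0$ for $c\in C_r$; $u_c(s_c-du^a_c-\sum_{h\in H_c}s_{hc})=0$ for $c\in C_a$. **UMFS** (Uniform Market Clearing Feasible Set)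 is the set of all points $(x,y,u,n,\pi,v,s,d^a,d^r,du^a,du^r)$, with $d^a,d^r$ indexed by all of $J$ and $du^a,du^r$ indexed by all of $C$, satisfying: - $\sum_i\lambda^iP_ix_i+\sum_{c\in C,h\in H_c}\lambda^{hc}P_{hc}x_{hc}+\sum_{j,t}\lambda^jP^t_jy_j\ \ge\ \sum_is_i+\sum_js_j+\sum_cs_c-\sum_{j\in J}d^a_j+\sum_mw_mv_m$; - $x_i\le1$ ($i\in I$); $y_j\le1$ ($j\in J$); $x_{hc}\le u_c$ ($h\in H_c,c\in C$); $u_c\le1$ ($c\in C$); - $\sum_{i\in I_{lt}}P_ix_i+\sum_{j\in J_l}P^t_jy_j+\sum_{hc\in HC_{lt}}P_{hc}x_{hc}=\sum_ke^k_{l,t}n_k$ for all $(l,t)$; $\sum_ka_{m,k}n_k\le w_m$ ($m\in N$); - $x,y,u\ge0$; $y,u$ integer; - $s_i+P_i\pi_{l(i),t(i)}\ge P_i\lambda^i$ ($i\in I$); $s_{hc}+P_{hc}\pi_{l(hc),t(hc)}\ge P_{hc}\lambda^{hc}$ ($h\in H_c,c\in C$); - $s_j+d^r_j-d^a_j+\sum_tP^t_j\pi_{l(j),t}\ge P_j\lambda^j$ ($j\in J$); $s_c+du^r_c\ge\sum_{h\in H_c}s_{hc}$ ($c\in C$); - $d^r_j\le M_j(1-y_j)$ and $d^a_j\le M_jy_j$ ($j\in J$); $du^r_c\le M_c(1-u_c)$ and $du^a_c=0$ ($c\in C$); - $\sum_ma_{m,k}v_m-\sum_{l,t}e^k_{l,t}\pi_{l,t}=0$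 ($k\in K$); - all components of $s,d^a,d^r,du^a,du^r,v$ are $\ge0$. *)

theory Defs
  imports Complex_Main "HOL-Library.FuncSet"
begin

text \<open>
  Index sets are explicit finite sets (possibly empty), so families are total functions of which
  only the values on the index sets are ever used. A suborder \<open>hc\<close> of a MIC bid \<open>c\<close> is given by the
  two arguments \<open>h\<close>, \<open>c\<close> with \<open>h \<in> subs D c\<close>; distinct MIC bids may share values \<open>h\<close>.
\<close>

record ('i, 'j, 'c, 'h, 'l, 't, 'm, 'k) market =
  hourly :: "'i set"                          (* I *)
  blocks :: "'j set"                          (* J *)
  mics :: "'c set"                            (* C *)
  subs :: "'c \<Rightarrow> 'h set"            (* H_c *)
  locs :: "'l set"
  slots :: "'t set"
  netcons :: "'m set"                         (* N *)
  netvars :: "'k set"                         (* K *)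
  locI :: "'i \<Rightarrow> 'l"
  slotI :: "'i \<Rightarrow> 't"
  locH :: "'h \<Rightarrow> 'c \<Rightarrow> 'l"
  slotH :: "'h \<Rightarrow> 'c \<Rightarrow> 't"
  locJ :: "'j \<Rightarrow> 'l"
  powI :: "'i \<Rightarrow> real"              (* P_i *)
  powH :: "'h \<Rightarrow> 'c \<Rightarrow> real"  (* P_hc *)
  powJ :: "'j \<Rightarrow> 't \<Rightarrow> real"  (* P_j^t *)
  limI :: "'i \<Rightarrow> real"              (* limit prices lambda *)
  limH :: "'h \<Rightarrow> 'c \<Rightarrow> real"
  limJ :: "'j \<Rightarrow> real"
  netA :: "'m \<Rightarrow> 'k \<Rightarrow> real"  (* a_{m,k} *)
  netE :: "'k \<Rightarrow> 'l \<Rightarrow> 't \<Rightarrow> real"  (* e^k_{l,t} *)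
  netW :: "'m \<Rightarrow> real"              (* w_m *)

record ('i, 'j, 'c, 'h, 'l, 't, 'm, 'k) point =
  xI :: "'i \<Rightarrow> real"
  xH :: "'h \<Rightarrow> 'c \<Rightarrow> real"
  yJ :: "'j \<Rightarrow> real"
  uC :: "'c \<Rightarrow> real"
  nK :: "'k \<Rightarrow> real"
  price :: "'l \<Rightarrow> 't \<Rightarrow> real"   (* pi_{l,t} *)
  vM :: "'m \<Rightarrow> real"
  sI :: "'i \<Rightarrow> real"
  sJ :: "'j \<Rightarrow> real"
  sH :: "'h \<Rightarrow> 'c \<Rightarrow> real"
  sC :: "'c \<Rightarrow> real"
  dA :: "'j \<Rightarrow> real"
  dR :: "'j \<Rightarrow> real"
  duA :: "'c \<Rightarrow> real"
  duR :: "'c \<Rightarrow> real"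

locale power_market =
  fixes D :: "('i, 'j, 'c, 'h, 'l, 't, 'm, 'k) market"
    and pibar :: real
    and MJ :: "'j \<Rightarrow> real"
    and MC :: "'c \<Rightarrow> real"
  assumes finite_hourly: "finite (hourly D)"
    and finite_blocks: "finite (blocks D)"
    and finite_mics: "finite (mics D)"
    and finite_subs: "\<And>c. c \<in> mics D \<Longrightarrow> finite (subs D c)"
    and finite_locs: "finite (locs D)"
    and finite_slots: "finite (slots D)"
    and finite_netcons: "finite (netcons D)"
    and finite_netvars: "finite (netvars D)"
    and locI: "\<And>i. i \<in> hourly D \<Longrightarrow> locI D i \<in> locs D"
    and slotI: "\<And>i. i \<in> hourly D \<Longrightarrow> slotI D i \<in> slots D"
    and locH: "\<And>h c. c \<in> mics D \<Longrightarrow> h \<in> subs D c \<Longrightarrow> locH D h c \<in> locs D"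
    and slotH: "\<And>h c. c \<in> mics D \<Longrightarrow> h \<in> subs D c \<Longrightarrow> slotH D h c \<in> slots D"
    and locJ: "\<And>j. j \<in> blocks D \<Longrightarrow> locJ D j \<in> locs D"
    and pibar_pos: "pibar > 0"
    and limI: "\<And>i. i \<in> hourly D \<Longrightarrow> limI D i \<in> {-pibar..pibar}"
    and limH: "\<And>h c. c \<in> mics D \<Longrightarrow> h \<in> subs D c \<Longrightarrow> limH D h c \<in> {-pibar..pibar}"
    and limJ: "\<And>j. j \<in> blocks D \<Longrightarrow> limJ D j \<in> {-pibar..pibar}"
    and MJ: "\<And>j. j \<in> blocks D \<Longrightarrow> MJ j \<ge> 2 * pibar * (\<Sum>t\<in>slots D. \<bar>powJ D j t\<bar>)"
    and MC: "\<And>c. c \<in> mics D \<Longrightarrow> MC c \<ge> 2 * pibar * (\<Sum>h\<in>subs D c. \<bar>powH D h c\<bar>)"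

definition price_range ::
  "('i, 'j, 'c, 'h, 'l, 't, 'm, 'k) market \<Rightarrow> real
    \<Rightarrow> ('i, 'j, 'c, 'h, 'l, 't, 'm, 'k) point \<Rightarrow> bool" where
  "price_range D pibar p \<longleftrightarrow>
    (\<forall>l\<in>locs D. \<forall>t\<in>slots D. price p l t \<in> {-pibar..pibar})"

definition is_partition :: "'a set \<Rightarrow> 'a set \<Rightarrow> 'a set \<Rightarrow> bool" where
  "is_partition X A B \<longleftrightarrow> X = A \<union> B \<and> A \<inter> B = {}"

definition balance ::
  "('i, 'j, 'c, 'h, 'l, 't, 'm, 'k) market
    \<Rightarrow> ('i, 'j, 'c, 'h, 'l, 't, 'm, 'k) point \<Rightarrow> bool" where
  "balance D p \<longleftrightarrow> (\<forall>l\<in>locs D. \<forall>t\<in>slots D.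
      (\<Sum>i\<in>{i \<in> hourly D. locI D i = l \<and> slotI D i = t}. powI D i * xI p i)
    + (\<Sum>j\<in>{j \<in> blocks D. locJ D j = l}. powJ D j t * yJ p j)
    + (\<Sum>(h, c)\<in>{(h, c). c \<in> mics D \<and> h \<in> subs D c \<and> locH D h c = l \<and> slotH D h c = t}.
          powH D h c * xH p h c)
    = (\<Sum>k\<in>netvars D. netE D k l t * nK p k))"

definition common_primal ::
  "('i, 'j, 'c, 'h, 'l, 't, 'm, 'k) market
    \<Rightarrow> ('i, 'j, 'c, 'h, 'l, 't, 'm, 'k) point \<Rightarrow> bool" where
  "common_primal D p \<longleftrightarrow>
    (\<forall>i\<in>hourly D. xI p i \<le> 1) \<and>
    (\<forall>j\<in>blocks D. yJ p j \<le> 1) \<and>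
    (\<forall>c\<in>mics D. \<forall>h\<in>subs D c. xH p h c \<le> uC p c) \<and>
    (\<forall>c\<in>mics D. uC p c \<le> 1) \<and>
    balance D p \<and>
    (\<forall>m\<in>netcons D. (\<Sum>k\<in>netvars D. netA D m k * nK p k) \<le> netW D m) \<and>
    (\<forall>i\<in>hourly D. xI p i \<ge> 0) \<and>
    (\<forall>c\<in>mics D. \<forall>h\<in>subs D c. xH p h c \<ge> 0) \<and>
    (\<forall>j\<in>blocks D. yJ p j \<ge> 0 \<and> yJ p j \<in> \<int>) \<and>
    (\<forall>c\<in>mics D. uC p c \<ge> 0 \<and> uC p c \<in> \<int>)"

definition primal ::
  "('i, 'j, 'c, 'h, 'l, 't, 'm, 'k) market
    \<Rightarrow> 'j set \<Rightarrow> 'j set \<Rightarrow> 'c set \<Rightarrow> 'c set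
    \<Rightarrow> ('i, 'j, 'c, 'h, 'l, 't, 'm, 'k) point \<Rightarrow> bool" where
  "primal D Jr Ja Cr Ca p \<longleftrightarrow>
    common_primal D p \<and>
    (\<forall>j\<in>Ja. - yJ p j \<le> -1) \<and>
    (\<forall>j\<in>Jr. yJ p j \<le> 0) \<and>
    (\<forall>c\<in>Ca. - uC p c \<le> -1) \<and>
    (\<forall>c\<in>Cr. uC p c \<le> 0)"

definition common_dual ::
  "('i, 'j, 'c, 'h, 'l, 't, 'm, 'k) market
    \<Rightarrow> ('i, 'j, 'c, 'h, 'l, 't, 'm, 'k) point \<Rightarrow> bool" where
  "common_dual D p \<longleftrightarrow>
    (\<forall>i\<in>hourly D.
      sI p i + powI D i * price p (locI D i) (slotI D i) \<ge> powI D i * limI D i) \<and>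
    (\<forall>c\<in>mics D. \<forall>h\<in>subs D c.
      sH p h c + powH D h c * price p (locH D h c) (slotH D h c) \<ge> powH D h c * limH D h c) \<and>
    (\<forall>k\<in>netvars D.
      (\<Sum>m\<in>netcons D. netA D m k * vM p m)
      - (\<Sum>l\<in>locs D. \<Sum>t\<in>slots D. netE D k l t * price p l t) = 0) \<and>
    (\<forall>i\<in>hourly D. sI p i \<ge> 0) \<and>
    (\<forall>j\<in>blocks D. sJ p j \<ge> 0) \<and>
    (\<forall>c\<in>mics D. sC p c \<ge> 0) \<and>
    (\<forall>c\<in>mics D. \<forall>h\<in>subs D c. sH p h c \<ge> 0) \<and>
    (\<forall>m\<in>netcons D. vM p m \<ge> 0)"

definition dual ::
  "('i, 'j, 'c, 'h, 'l, 't, 'm, 'k) market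
    \<Rightarrow> 'j set \<Rightarrow> 'j set \<Rightarrow> 'c set \<Rightarrow> 'c set
    \<Rightarrow> ('i, 'j, 'c, 'h, 'l, 't, 'm, 'k) point \<Rightarrow> bool" where
  "dual D Jr Ja Cr Ca p \<longleftrightarrow>
    common_dual D p \<and>
    (\<forall>j\<in>Jr. sJ p j + dR p j + (\<Sum>t\<in>slots D. powJ D j t * price p (locJ D j) t)
      \<ge> (\<Sum>t\<in>slots D. powJ D j t * limJ D j)) \<and>
    (\<forall>j\<in>Ja. sJ p j - dA p j + (\<Sum>t\<in>slots D. powJ D j t * price p (locJ D j) t)
      \<ge> (\<Sum>t\<in>slots D. powJ D j t * limJ D j)) \<and>
    (\<forall>c\<in>Cr. sC p c + duR p c \<ge> (\<Sum>h\<in>subs D c. sH p h c)) \<and>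
    (\<forall>c\<in>Ca. sC p c - duA p c \<ge> (\<Sum>h\<in>subs D c. sH p h c)) \<and>
    (\<forall>j\<in>Jr. dR p j \<ge> 0) \<and>
    (\<forall>j\<in>Ja. dA p j \<ge> 0) \<and>
    (\<forall>c\<in>Cr. duR p c \<ge> 0) \<and>
    (\<forall>c\<in>Ca. duA p c \<ge> 0)"

definition complementarity ::
  "('i, 'j, 'c, 'h, 'l, 't, 'm, 'k) market
    \<Rightarrow> 'j set \<Rightarrow> 'j set \<Rightarrow> 'c set \<Rightarrow> 'c set
    \<Rightarrow> ('i, 'j, 'c, 'h, 'l, 't, 'm, 'k) point \<Rightarrow> bool" where
  "complementarity D Jr Ja Cr Ca p \<longleftrightarrow>
    (\<forall>i\<in>hourly D. sI p i * (1 - xI p i) = 0) \<and>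
    (\<forall>j\<in>blocks D. sJ p j * (1 - yJ p j) = 0) \<and>
    (\<forall>c\<in>mics D. \<forall>h\<in>subs D c. sH p h c * (uC p c - xH p h c) = 0) \<and>
    (\<forall>c\<in>mics D. sC p c * (1 - uC p c) = 0) \<and>
    (\<forall>m\<in>netcons D. vM p m * ((\<Sum>k\<in>netvars D. netA D m k * nK p k) - netW D m) = 0) \<and>
    (\<forall>j\<in>Ja. (1 - yJ p j) * dA p j = 0) \<and>
    (\<forall>j\<in>Jr. yJ p j * dR p j = 0) \<and>
    (\<forall>c\<in>Ca. (1 - uC p c) * duA p c = 0) \<and>
    (\<forall>c\<in>Cr. uC p c * duR p c = 0) \<and>
    (\<forall>i\<in>hourly D.
      xI p i * (sI p i + powI D i * price p (locI D i) (slotI D i) - powI D i * limI D i) = 0) \<and>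
    (\<forall>c\<in>mics D. \<forall>h\<in>subs D c.
      xH p h c * (sH p h c + powH D h c * price p (locH D h c) (slotH D h c)
        - powH D h c * limH D h c) = 0) \<and>
    (\<forall>j\<in>Jr.
      yJ p j * (sJ p j + dR p j
        + (\<Sum>t\<in>slots D. powJ D j t * (price p (locJ D j) t - limJ D j))) = 0) \<and>
    (\<forall>j\<in>Ja.
      yJ p j * (sJ p j - dA p j
        + (\<Sum>t\<in>slots D. powJ D j t * (price p (locJ D j) t - limJ D j))) = 0) \<and>
    (\<forall>c\<in>Cr. uC p c * (sC p c + duR p c - (\<Sum>h\<in>subs D c. sH p h c)) = 0) \<and>
    (\<forall>c\<in>Ca. uC p c * (sC p c - duA p c - (\<Sum>h\<in>subs D c. sH p h c)) = 0)"

definition umfs ::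
  "('i, 'j, 'c, 'h, 'l, 't, 'm, 'k) market
    \<Rightarrow> ('j \<Rightarrow> real) \<Rightarrow> ('c \<Rightarrow> real)
    \<Rightarrow> ('i, 'j, 'c, 'h, 'l, 't, 'm, 'k) point set" where
  "umfs D MJ MC = {p.
    (\<Sum>i\<in>hourly D. limI D i * powI D i * xI p i)
      + (\<Sum>c\<in>mics D. \<Sum>h\<in>subs D c. limH D h c * powH D h c * xH p h c)
      + (\<Sum>j\<in>blocks D. \<Sum>t\<in>slots D. limJ D j * powJ D j t * yJ p j)
    \<ge> (\<Sum>i\<in>hourly D. sI p i) + (\<Sum>j\<in>blocks D. sJ p j) + (\<Sum>c\<in>mics D. sC p c)
      - (\<Sum>j\<in>blocks D. dA p j) + (\<Sum>m\<in>netcons D. netW D m * vM p m) \<and>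
    common_primal D p \<and>
    common_dual D p \<and>
    (\<forall>j\<in>blocks D.
      sJ p j + dR p j - dA p j + (\<Sum>t\<in>slots D. powJ D j t * price p (locJ D j) t)
      \<ge> (\<Sum>t\<in>slots D. powJ D j t * limJ D j)) \<and>
    (\<forall>c\<in>mics D. sC p c + duR p c \<ge> (\<Sum>h\<in>subs D c. sH p h c)) \<and>
    (\<forall>j\<in>blocks D. dR p j \<le> MJ j * (1 - yJ p j)) \<and>
    (\<forall>j\<in>blocks D. dA p j \<le> MJ j * yJ p j) \<and>
    (\<forall>c\<in>mics D. duR p c \<le> MC c * (1 - uC p c)) \<and>
    (\<forall>c\<in>mics D. duA p c = 0) \<and>
    (\<forall>j\<in>blocks D. dA p j \<ge> 0 \<and> dR p j \<ge> 0) \<and>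
    (\<forall>c\<in>mics D. duA p c \<ge> 0 \<and> duR p c \<ge> 0)}"

text \<open>Forgets the components of \<open>dA\<close>, \<open>dR\<close>, \<open>duA\<close>, \<open>duR\<close> outside the relevant partition classes.\<close>

definition project ::
  "'j set \<Rightarrow> 'j set \<Rightarrow> 'c set \<Rightarrow> 'c set
    \<Rightarrow> ('i, 'j, 'c, 'h, 'l, 't, 'm, 'k) point
    \<Rightarrow> ('i, 'j, 'c, 'h, 'l, 't, 'm, 'k) point" where
  "project Jr Ja Cr Ca p =
    p\<lparr>dA := restrict (dA p) Ja, dR := restrict (dR p) Jr,
      duA := restrict (duA p) Ca, duR := restrict (duR p) Cr\<rparr>"

end

theory Submission imports Defs begin

text \<open>
  Weak duality is an identity: by the balance constraints and the network dual equation, the duality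
  gap (dual minus primal objective) is a sum of one term per hourly bid, block bid, MIC bid and
  network constraint. At a point of UMFS the big-M constraints annihilate the multipliers of the
  wrong partition class, so every term is a sum of products of nonnegative factors; since the gap is
  \<open>\<le> 0\<close>, all these products vanish, which is complementarity. Conversely, the multipliers can be
  replaced by the smallest ones that the prices allow. These respect the big-M bounds because prices
  and limit prices lie in \<open>[-pibar, pibar]\<close>, and every term of the gap remains zero.
\<close>

section \<open>Regrouping sums by location and time slot; binary variables\<close>

text \<open>Every \<open>a\<close> lies in exactly one cell \<open>(f a, g a)\<close> of
  \<open>L \<times> T\<close>, where the weight \<open>q l t\<close> is constant. This turns market
  balances weighted by prices into revenues of individual bids.\<close>

lemma sum_weighted_group:
  fixes q :: "'l \<Rightarrow> 't \<Rightarrow> real"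
  assumes "finite A" "finite L" "finite T" "f ` A \<subseteq> L" "g ` A \<subseteq> T"
  shows "(\<Sum>l\<in>L. \<Sum>t\<in>T. q l t * (\<Sum>a\<in>{a\<in>A. f a = l \<and> g a = t}. w a))
    = (\<Sum>a\<in>A. w a * q (f a) (g a))"
proof -
  have "(\<Sum>l\<in>L. \<Sum>t\<in>T. q l t * (\<Sum>a\<in>{a\<in>A. f a = l \<and> g a = t}. w a))
      = (\<Sum>z\<in>L \<times> T. \<Sum>a\<in>{a\<in>A. (f a, g a) = z}. w a * q (f a) (g a))"
    by (subst sum.cartesian_product) (auto simp: sum_distrib_left mult.commute intro!: sum.cong)
  also have "\<dots> = (\<Sum>a\<in>A. w a * q (f a) (g a))"
    using assms by (intro sum.group) auto
  finally show ?thesis .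
qed

text \<open>The version for block bids: such a bid has one location but a profile over all time
  slots, so only the location is grouped and \<open>T\<close> is carried along.\<close>

lemma sum_weighted_group1:
  fixes q :: "'l \<Rightarrow> 't \<Rightarrow> real"
  assumes "finite A" "finite L" "f ` A \<subseteq> L"
  shows "(\<Sum>l\<in>L. \<Sum>t\<in>T. q l t * (\<Sum>a\<in>{a\<in>A. f a = l}. w a t))
    = (\<Sum>a\<in>A. \<Sum>t\<in>T. w a t * q (f a) t)"
proof -
  have "(\<Sum>l\<in>L. \<Sum>t\<in>T. q l t * (\<Sum>a\<in>{a\<in>A. f a = l}. w a t))
      = (\<Sum>l\<in>L. \<Sum>t\<in>T. \<Sum>a\<in>{a\<in>A. f a = l}. w a t * q (f a) t)"
    by (auto simp: sum_distrib_left mult.commute intro!: sum.cong)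
  also have "\<dots> = (\<Sum>l\<in>L. \<Sum>a\<in>{a\<in>A. f a = l}. \<Sum>t\<in>T. w a t * q (f a) t)"
    by (intro sum.cong refl sum.swap)
  also have "\<dots> = (\<Sum>a\<in>A. \<Sum>t\<in>T. w a t * q (f a) t)"
    using assms by (intro sum.group) auto
  finally show ?thesis .
qed

lemma Ints_unit_interval:
  fixes y :: real
  assumes "y \<in> \<int>" "0 \<le> y" "y \<le> 1"
  shows "y = 0 \<or> y = 1"
proof -
  obtain k where "y = of_int k" using assms(1) by (rule Ints_cases)
  with assms(2,3) show ?thesis by (cases "k = 0") auto
qed

lemma is_partition_binary:
  fixes f :: "'a \<Rightarrow> real"
  assumes "\<And>a. a \<in> A \<Longrightarrow> f a = 0 \<or> f a = 1"
  shows "is_partition A {a \<in> A. f a = 0} {a \<in> A. f a = 1}"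
  using assms by (auto simp: is_partition_def)

section \<open>The terms of the duality gap\<close>

text \<open>The four \<open>gap\<close> functions are the shares of single bids and network
  constraints in dual minus primal objective. Each bid is charged the price of its executed
  quantity, and \<open>gapM\<close> subtracts the congestion payment; these additions cancel in the
  total. Multipliers that enter neither objective, such as \<open>dR\<close>, \<open>sH\<close> and
  \<open>duR\<close>, are absent.\<close>

definition gapI where
  "gapI D p i = sI p i + xI p i * (powI D i * price p (locI D i) (slotI D i) - powI D i * limI D i)"

definition gapJ where
  "gapJ D p j = sJ p j - dA p j
    + yJ p j * (\<Sum>t\<in>slots D. powJ D j t * (price p (locJ D j) t - limJ D j))"

definition gapC where
  "gapC D p c = sC p c
    + (\<Sum>h\<in>subs D c. xH p h c *
        (powH D h c * price p (locH D h c) (slotH D h c) - powH D h c * limH D h c))"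

definition gapM where
  "gapM D p m = vM p m * (netW D m - (\<Sum>k\<in>netvars D. netA D m k * nK p k))"

context power_market
begin

text \<open>Multiply the balance at \<open>(l, t)\<close> by its price, sum over all cells, and
  regroup by bid.\<close>

lemma balance_revenue:
  assumes "balance D p"
  shows "(\<Sum>l\<in>locs D. \<Sum>t\<in>slots D. price p l t * (\<Sum>k\<in>netvars D. netE D k l t * nK p k))
    = (\<Sum>i\<in>hourly D. powI D i * xI p i * price p (locI D i) (slotI D i))
    + (\<Sum>j\<in>blocks D. \<Sum>t\<in>slots D. powJ D j t * yJ p j * price p (locJ D j) t)
    + (\<Sum>c\<in>mics D. \<Sum>h\<in>subs D c. powH D h c * xH p h c * price p (locH D h c) (slotH D h c))"
proof -
  let ?Z = "Sigma (mics D) (subs D)"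
  \<comment> \<open>The balance indexes suborders by pairs \<open>(h, c)\<close>, whereas
    \<open>Sigma\<close> yields pairs \<open>(c, h)\<close>; swapping the components gives the form
    that the grouping lemma and \<open>sum.Sigma\<close> accept.\<close>
  have H: "(\<Sum>(h, c)\<in>{(h, c). c \<in> mics D \<and> h \<in> subs D c \<and> locH D h c = l \<and> slotH D h c = t}.
        powH D h c * xH p h c)
      = (\<Sum>z\<in>{z\<in>?Z. locH D (snd z) (fst z) = l \<and> slotH D (snd z) (fst z) = t}.
        powH D (snd z) (fst z) * xH p (snd z) (fst z))" for l t
    by (rule sum.reindex_bij_witness[where i = prod.swap and j = prod.swap]) auto
  have fZ: "finite ?Z" using finite_mics finite_subs by auto
  have "(\<Sum>l\<in>locs D. \<Sum>t\<in>slots D. price p l t * (\<Sum>k\<in>netvars D. netE D k l t * nK p k))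
    = (\<Sum>l\<in>locs D. \<Sum>t\<in>slots D. price p l t *
        (\<Sum>i\<in>{i \<in> hourly D. locI D i = l \<and> slotI D i = t}. powI D i * xI p i))
    + (\<Sum>l\<in>locs D. \<Sum>t\<in>slots D. price p l t *
        (\<Sum>j\<in>{j \<in> blocks D. locJ D j = l}. powJ D j t * yJ p j))
    + (\<Sum>l\<in>locs D. \<Sum>t\<in>slots D. price p l t *
        (\<Sum>z\<in>{z\<in>?Z. locH D (snd z) (fst z) = l \<and> slotH D (snd z) (fst z) = t}.
          powH D (snd z) (fst z) * xH p (snd z) (fst z)))"
    unfolding sum.distrib[symmetric] H[symmetric]
    using assms unfolding balance_def
    by (intro sum.cong refl) (simp add: distrib_left[symmetric])
  also have "(\<Sum>l\<in>locs D. \<Sum>t\<in>slots D. price p l t *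
        (\<Sum>i\<in>{i \<in> hourly D. locI D i = l \<and> slotI D i = t}. powI D i * xI p i))
    = (\<Sum>i\<in>hourly D. powI D i * xI p i * price p (locI D i) (slotI D i))"
    using finite_hourly finite_locs finite_slots locI slotI by (intro sum_weighted_group) auto
  also have "(\<Sum>l\<in>locs D. \<Sum>t\<in>slots D. price p l t *
        (\<Sum>j\<in>{j \<in> blocks D. locJ D j = l}. powJ D j t * yJ p j))
    = (\<Sum>j\<in>blocks D. \<Sum>t\<in>slots D. powJ D j t * yJ p j * price p (locJ D j) t)"
    using finite_blocks finite_locs locJ by (intro sum_weighted_group1) auto
  also have "(\<Sum>l\<in>locs D. \<Sum>t\<in>slots D. price p l t *
        (\<Sum>z\<in>{z\<in>?Z. locH D (snd z) (fst z) = l \<and> slotH D (snd z) (fst z) = t}.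
          powH D (snd z) (fst z) * xH p (snd z) (fst z)))
    = (\<Sum>z\<in>?Z. powH D (snd z) (fst z) * xH p (snd z) (fst z)
        * price p (locH D (snd z) (fst z)) (slotH D (snd z) (fst z)))"
    using fZ finite_locs finite_slots locH slotH by (intro sum_weighted_group) auto
  also have "\<dots> = (\<Sum>c\<in>mics D. \<Sum>h\<in>subs D c.
      powH D h c * xH p h c * price p (locH D h c) (slotH D h c))"
    using finite_mics finite_subs by (simp add: sum.Sigma case_prod_unfold)
  finally show ?thesis .
qed

text \<open>Multiply the network dual equation of \<open>k\<close> by \<open>nK p k\<close>, sum
  over \<open>k\<close>, and interchange the sums.\<close>

lemma congestion_revenue:
  assumes "\<And>k. k \<in> netvars D \<Longrightarrow> (\<Sum>m\<in>netcons D. netA D m k * vM p m)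
      = (\<Sum>l\<in>locs D. \<Sum>t\<in>slots D. netE D k l t * price p l t)"
  shows "(\<Sum>m\<in>netcons D. vM p m * (\<Sum>k\<in>netvars D. netA D m k * nK p k))
    = (\<Sum>l\<in>locs D. \<Sum>t\<in>slots D. price p l t * (\<Sum>k\<in>netvars D. netE D k l t * nK p k))"
proof -
  have "(\<Sum>m\<in>netcons D. vM p m * (\<Sum>k\<in>netvars D. netA D m k * nK p k))
      = (\<Sum>m\<in>netcons D. \<Sum>k\<in>netvars D. nK p k * (netA D m k * vM p m))"
    by (simp add: sum_distrib_left mult_ac)
  also have "\<dots> = (\<Sum>k\<in>netvars D. nK p k * (\<Sum>m\<in>netcons D. netA D m k * vM p m))"
    by (subst sum.swap) (simp add: sum_distrib_left)
  also have "\<dots> = (\<Sum>k\<in>netvars D. \<Sum>l\<in>locs D. \<Sum>t\<in>slots D.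
      nK p k * (netE D k l t * price p l t))"
    by (simp add: assms sum_distrib_left)
  also have "\<dots> = (\<Sum>l\<in>locs D. \<Sum>k\<in>netvars D. \<Sum>t\<in>slots D.
      nK p k * (netE D k l t * price p l t))"
    by (rule sum.swap)
  also have "\<dots> = (\<Sum>l\<in>locs D. \<Sum>t\<in>slots D. \<Sum>k\<in>netvars D.
      nK p k * (netE D k l t * price p l t))"
    by (intro sum.cong refl sum.swap)
  also have "\<dots> = (\<Sum>l\<in>locs D. \<Sum>t\<in>slots D. price p l t * (\<Sum>k\<in>netvars D. netE D k l t * nK p k))"
    by (simp add: sum_distrib_left mult_ac)
  finally show ?thesis .
qed

text \<open>The price terms of the bids add up to the revenue in \<open>balance_revenue\<close>,
  which \<open>congestion_revenue\<close> equates with the payment subtracted in the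
  \<open>gapM\<close> terms. What remains is the difference of the objectives.\<close>

lemma duality_gap:
  assumes "common_primal D p" "common_dual D p"
  shows "(\<Sum>i\<in>hourly D. sI p i) + (\<Sum>j\<in>blocks D. sJ p j) + (\<Sum>c\<in>mics D. sC p c)
      - (\<Sum>j\<in>blocks D. dA p j) + (\<Sum>m\<in>netcons D. netW D m * vM p m)
      - ((\<Sum>i\<in>hourly D. limI D i * powI D i * xI p i)
        + (\<Sum>c\<in>mics D. \<Sum>h\<in>subs D c. limH D h c * powH D h c * xH p h c)
        + (\<Sum>j\<in>blocks D. \<Sum>t\<in>slots D. limJ D j * powJ D j t * yJ p j))
    = (\<Sum>i\<in>hourly D. gapI D p i) + (\<Sum>j\<in>blocks D. gapJ D p j)
      + (\<Sum>c\<in>mics D. gapC D p c) + (\<Sum>m\<in>netcons D. gapM D p m)"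
proof -
  have bal: "balance D p" using assms by (simp add: common_primal_def)
  have net: "(\<Sum>m\<in>netcons D. netA D m k * vM p m)
      = (\<Sum>l\<in>locs D. \<Sum>t\<in>slots D. netE D k l t * price p l t)" if "k \<in> netvars D" for k
    using assms that by (simp add: common_dual_def)
  have I: "(\<Sum>i\<in>hourly D. gapI D p i) = (\<Sum>i\<in>hourly D. sI p i)
      + (\<Sum>i\<in>hourly D. powI D i * xI p i * price p (locI D i) (slotI D i))
      - (\<Sum>i\<in>hourly D. limI D i * powI D i * xI p i)"
    by (simp add: gapI_def sum.distrib sum_subtractf algebra_simps)
  have J: "(\<Sum>j\<in>blocks D. gapJ D p j) = (\<Sum>j\<in>blocks D. sJ p j) - (\<Sum>j\<in>blocks D. dA p j)
      + (\<Sum>j\<in>blocks D. \<Sum>t\<in>slots D. powJ D j t * yJ p j * price p (locJ D j) t)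
      - (\<Sum>j\<in>blocks D. \<Sum>t\<in>slots D. limJ D j * powJ D j t * yJ p j)"
    by (simp add: gapJ_def sum.distrib sum_subtractf sum_distrib_left algebra_simps)
  have C: "(\<Sum>c\<in>mics D. gapC D p c) = (\<Sum>c\<in>mics D. sC p c)
      + (\<Sum>c\<in>mics D. \<Sum>h\<in>subs D c. powH D h c * xH p h c * price p (locH D h c) (slotH D h c))
      - (\<Sum>c\<in>mics D. \<Sum>h\<in>subs D c. limH D h c * powH D h c * xH p h c)"
    by (simp add: gapC_def sum.distrib sum_subtractf algebra_simps)
  have M: "(\<Sum>m\<in>netcons D. gapM D p m) = (\<Sum>m\<in>netcons D. netW D m * vM p m)
      - (\<Sum>m\<in>netcons D. vM p m * (\<Sum>k\<in>netvars D. netA D m k * nK p k))"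
    by (simp add: gapM_def right_diff_distrib sum_subtractf mult.commute)
  show ?thesis
    using congestion_revenue[of p, OF net] balance_revenue[OF bal] unfolding I J C M by simp
qed

text \<open>Here and in the next two identities, multipliers times executed quantities are added and
  subtracted, so that the products of the complementarity conditions appear.\<close>

lemma gapI_eq:
  "gapI D p i = sI p i * (1 - xI p i)
    + xI p i * (sI p i + powI D i * price p (locI D i) (slotI D i) - powI D i * limI D i)"
  by (simp add: gapI_def algebra_simps)

lemma gapJ_eq:
  "gapJ D p j = sJ p j * (1 - yJ p j) - dA p j * (1 - yJ p j) - dR p j * yJ p j
    + yJ p j * (sJ p j + dR p j - dA p j
        + (\<Sum>t\<in>slots D. powJ D j t * (price p (locJ D j) t - limJ D j)))"
  by (simp add: gapJ_def algebra_simps)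

text \<open>The multipliers \<open>sH\<close> and \<open>duR\<close> cancel on the right. They are
  inserted to link the MIC bid with its suborders: \<open>uC p c\<close> times the sum of
  \<open>sH\<close> is split between the MIC constraint and the bounds
  \<open>xH p h c \<le> uC p c\<close>.\<close>

lemma gapC_eq:
  "gapC D p c = sC p c * (1 - uC p c) - uC p c * duR p c
    + uC p c * (sC p c + duR p c - (\<Sum>h\<in>subs D c. sH p h c))
    + (\<Sum>h\<in>subs D c. sH p h c * (uC p c - xH p h c))
    + (\<Sum>h\<in>subs D c. xH p h c * (sH p h c + powH D h c * price p (locH D h c) (slotH D h c)
        - powH D h c * limH D h c))"
  by (simp add: gapC_def sum.distrib sum_subtractf sum_distrib_left algebra_simps)

text \<open>The bounds behind the choice of the big-M constants.\<close>

lemma surplusJ_bound: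
  assumes "j \<in> blocks D" "price_range D pibar p"
  shows "\<bar>\<Sum>t\<in>slots D. powJ D j t * (price p (locJ D j) t - limJ D j)\<bar> \<le> MJ j"
proof -
  have "\<bar>powJ D j t * (price p (locJ D j) t - limJ D j)\<bar> \<le> 2 * pibar * \<bar>powJ D j t\<bar>"
    if "t \<in> slots D" for t
  proof -
    have "\<bar>price p (locJ D j) t - limJ D j\<bar> \<le> 2 * pibar"
      using assms that locJ[OF assms(1)] limJ[OF assms(1)] by (force simp: price_range_def)
    then show ?thesis by (simp add: abs_mult mult.commute mult_left_mono)
  qed
  then have "\<bar>\<Sum>t\<in>slots D. powJ D j t * (price p (locJ D j) t - limJ D j)\<bar>
      \<le> (\<Sum>t\<in>slots D. 2 * pibar * \<bar>powJ D j t\<bar>)"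
    by (intro order_trans[OF sum_abs] sum_mono)
  with MJ[OF assms(1)] show ?thesis by (simp add: sum_distrib_left)
qed

lemma surplusH_bound:
  assumes "c \<in> mics D" "price_range D pibar p"
  shows "(\<Sum>h\<in>subs D c. max 0 (powH D h c * limH D h c
      - powH D h c * price p (locH D h c) (slotH D h c))) \<le> MC c"
proof -
  have "max 0 (powH D h c * limH D h c - powH D h c * price p (locH D h c) (slotH D h c))
      \<le> 2 * pibar * \<bar>powH D h c\<bar>" if "h \<in> subs D c" for h
  proof -
    have "\<bar>limH D h c - price p (locH D h c) (slotH D h c)\<bar> \<le> 2 * pibar"
      using assms locH[OF assms(1) that] slotH[OF assms(1) that] limH[OF assms(1) that]
      by (force simp: price_range_def)
    then have "\<bar>powH D h c * (limH D h c - price p (locH D h c) (slotH D h c))\<bar>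
        \<le> 2 * pibar * \<bar>powH D h c\<bar>"
      by (simp add: abs_mult mult.commute mult_left_mono)
    \<comment> \<open>Positivity of \<open>pibar\<close> makes the right-hand side nonnegative,
      which settles the branch \<open>0\<close> of the maximum.\<close>
    then show ?thesis using pibar_pos by (simp add: right_diff_distrib)
  qed
  then have "(\<Sum>h\<in>subs D c. max 0 (powH D h c * limH D h c
      - powH D h c * price p (locH D h c) (slotH D h c))) \<le> (\<Sum>h\<in>subs D c. 2 * pibar * \<bar>powH D h c\<bar>)"
    by (intro sum_mono)
  with MC[OF assms(1)] show ?thesis by (simp add: sum_distrib_left)
qed

section \<open>From UMFS to complementarity\<close>

lemma common_primal_binary:
  assumes "common_primal D p"
  shows "j \<in> blocks D \<Longrightarrow> yJ p j = 0 \<or> yJ p j = 1"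
    and "c \<in> mics D \<Longrightarrow> uC p c = 0 \<or> uC p c = 1"
  using assms by (simp_all add: common_primal_def Ints_unit_interval)

lemma umfs_gap_zero:
  assumes p: "p \<in> umfs D MJ MC"
  shows "i \<in> hourly D \<Longrightarrow> sI p i * (1 - xI p i) = 0"
    and "i \<in> hourly D \<Longrightarrow>
      xI p i * (sI p i + powI D i * price p (locI D i) (slotI D i) - powI D i * limI D i) = 0"
    and "j \<in> blocks D \<Longrightarrow> dA p j * (1 - yJ p j) = 0"
    and "j \<in> blocks D \<Longrightarrow> dR p j * yJ p j = 0"
    and "j \<in> blocks D \<Longrightarrow> sJ p j * (1 - yJ p j) = 0"
    and "j \<in> blocks D \<Longrightarrow> yJ p j * (sJ p j + dR p j - dA p j
        + (\<Sum>t\<in>slots D. powJ D j t * (price p (locJ D j) t - limJ D j))) = 0"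
    and "c \<in> mics D \<Longrightarrow> uC p c * duR p c = 0"
    and "c \<in> mics D \<Longrightarrow> sC p c * (1 - uC p c) = 0"
    and "c \<in> mics D \<Longrightarrow> uC p c * (sC p c + duR p c - (\<Sum>h\<in>subs D c. sH p h c)) = 0"
    and "c \<in> mics D \<Longrightarrow> h \<in> subs D c \<Longrightarrow> sH p h c * (uC p c - xH p h c) = 0"
    and "c \<in> mics D \<Longrightarrow> h \<in> subs D c \<Longrightarrow>
      xH p h c * (sH p h c + powH D h c * price p (locH D h c) (slotH D h c)
        - powH D h c * limH D h c) = 0"
    and "m \<in> netcons D \<Longrightarrow>
      vM p m * ((\<Sum>k\<in>netvars D. netA D m k * nK p k) - netW D m) = 0"
proof -
  have cp: "common_primal D p" and cd: "common_dual D p"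
    using p by (simp_all add: umfs_def)
  note bin = common_primal_binary[OF cp]
  have I1: "sI p i * (1 - xI p i) \<ge> 0"
    and I2: "xI p i * (sI p i + powI D i * price p (locI D i) (slotI D i) - powI D i * limI D i) \<ge> 0"
    if "i \<in> hourly D" for i
    using cp cd that by (auto simp: common_primal_def common_dual_def intro!: mult_nonneg_nonneg)
  \<comment> \<open>Since \<open>yJ p j\<close> is 0 or 1, one of the big-M bounds is 0 and its
    nonnegative multiplier vanishes.\<close>
  have dA0: "dA p j * (1 - yJ p j) = 0" and dR0: "dR p j * yJ p j = 0" if "j \<in> blocks D" for j
    using p bin(1)[OF that] that by (force simp: umfs_def)+
  have J1: "sJ p j * (1 - yJ p j) \<ge> 0" if "j \<in> blocks D" for j
    using cp cd that by (auto simp: common_primal_def common_dual_def intro!: mult_nonneg_nonneg)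
  have J2: "yJ p j * (sJ p j + dR p j - dA p j
        + (\<Sum>t\<in>slots D. powJ D j t * (price p (locJ D j) t - limJ D j))) \<ge> 0"
    if "j \<in> blocks D" for j
  proof -
    have "sJ p j + dR p j - dA p j + (\<Sum>t\<in>slots D. powJ D j t * price p (locJ D j) t)
        \<ge> (\<Sum>t\<in>slots D. powJ D j t * limJ D j)" "yJ p j \<ge> 0"
      using p cp that by (auto simp: umfs_def common_primal_def)
    then show ?thesis by (intro mult_nonneg_nonneg) (auto simp: right_diff_distrib sum_subtractf)
  qed
  have duR0: "uC p c * duR p c = 0" if "c \<in> mics D" for c
    using p bin(2)[OF that] that by (force simp: umfs_def)
  have C1: "sC p c * (1 - uC p c) \<ge> 0" if "c \<in> mics D" for c
    using cp cd that by (auto simp: common_primal_def common_dual_def intro!: mult_nonneg_nonneg)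
  have C2: "uC p c * (sC p c + duR p c - (\<Sum>h\<in>subs D c. sH p h c)) \<ge> 0" if "c \<in> mics D" for c
    using p cp that by (auto simp: umfs_def common_primal_def intro!: mult_nonneg_nonneg)
  have H1: "sH p h c * (uC p c - xH p h c) \<ge> 0"
    and H2: "xH p h c * (sH p h c + powH D h c * price p (locH D h c) (slotH D h c)
        - powH D h c * limH D h c) \<ge> 0" if "c \<in> mics D" "h \<in> subs D c" for c h
    using cp cd that by (auto simp: common_primal_def common_dual_def intro!: mult_nonneg_nonneg)
  have gI: "gapI D p i \<ge> 0" if "i \<in> hourly D" for i
    using I1[OF that] I2[OF that] by (simp add: gapI_eq)
  have gJ: "gapJ D p j \<ge> 0" if "j \<in> blocks D" for j
    using J1[OF that] J2[OF that] dA0[OF that] dR0[OF that] unfolding gapJ_eq by linarith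
  have HH1: "(\<Sum>h\<in>subs D c. sH p h c * (uC p c - xH p h c)) \<ge> 0"
    and HH2: "(\<Sum>h\<in>subs D c. xH p h c * (sH p h c
        + powH D h c * price p (locH D h c) (slotH D h c) - powH D h c * limH D h c)) \<ge> 0"
    if "c \<in> mics D" for c
    using H1 H2 that by (auto intro!: sum_nonneg)
  have gC: "gapC D p c \<ge> 0" if "c \<in> mics D" for c
    using C1[OF that] C2[OF that] duR0[OF that] HH1[OF that] HH2[OF that]
    unfolding gapC_eq by linarith
  have gM: "gapM D p m \<ge> 0" if "m \<in> netcons D" for m
    using cp cd that
    by (auto simp: gapM_def common_primal_def common_dual_def intro!: mult_nonneg_nonneg)
  \<comment> \<open>The objective inequality of UMFS says exactly that the total gap is at most
    0.\<close>
  have "(\<Sum>i\<in>hourly D. gapI D p i) + (\<Sum>j\<in>blocks D. gapJ D p j)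
      + (\<Sum>c\<in>mics D. gapC D p c) + (\<Sum>m\<in>netcons D. gapM D p m) \<le> 0"
    unfolding duality_gap[OF cp cd, symmetric] using p by (simp add: umfs_def)
  moreover have "(\<Sum>i\<in>hourly D. gapI D p i) \<ge> 0" "(\<Sum>j\<in>blocks D. gapJ D p j) \<ge> 0"
      "(\<Sum>c\<in>mics D. gapC D p c) \<ge> 0" "(\<Sum>m\<in>netcons D. gapM D p m) \<ge> 0"
    using gI gJ gC gM by (simp_all add: sum_nonneg)
  ultimately have "(\<Sum>i\<in>hourly D. gapI D p i) = 0" "(\<Sum>j\<in>blocks D. gapJ D p j) = 0"
      "(\<Sum>c\<in>mics D. gapC D p c) = 0" "(\<Sum>m\<in>netcons D. gapM D p m) = 0"
    by linarith+
  then have zI: "\<And>i. i \<in> hourly D \<Longrightarrow> gapI D p i = 0"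
    and zJ: "\<And>j. j \<in> blocks D \<Longrightarrow> gapJ D p j = 0"
    and zC: "\<And>c. c \<in> mics D \<Longrightarrow> gapC D p c = 0"
    and zM: "\<And>m. m \<in> netcons D \<Longrightarrow> gapM D p m = 0"
    using gI gJ gC gM finite_hourly finite_blocks finite_mics finite_netcons
    by (simp_all add: sum_nonneg_eq_0_iff)
  show "sI p i * (1 - xI p i) = 0"
    and "xI p i * (sI p i + powI D i * price p (locI D i) (slotI D i) - powI D i * limI D i) = 0"
    if "i \<in> hourly D"
    using I1[OF that] I2[OF that] zI[OF that] unfolding gapI_eq by linarith+
  show "sJ p j * (1 - yJ p j) = 0"
    and "yJ p j * (sJ p j + dR p j - dA p j
        + (\<Sum>t\<in>slots D. powJ D j t * (price p (locJ D j) t - limJ D j))) = 0"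
    and "dA p j * (1 - yJ p j) = 0" and "dR p j * yJ p j = 0"
    if "j \<in> blocks D"
    using J1[OF that] J2[OF that] dA0[OF that] dR0[OF that] zJ[OF that] unfolding gapJ_eq by linarith+
  have *: "sC p c * (1 - uC p c) = 0
      \<and> uC p c * (sC p c + duR p c - (\<Sum>h\<in>subs D c. sH p h c)) = 0
      \<and> (\<Sum>h\<in>subs D c. sH p h c * (uC p c - xH p h c)) = 0
      \<and> (\<Sum>h\<in>subs D c. xH p h c * (sH p h c
        + powH D h c * price p (locH D h c) (slotH D h c) - powH D h c * limH D h c)) = 0"
    if "c \<in> mics D"
    using C1[OF that] C2[OF that] duR0[OF that] HH1[OF that] HH2[OF that] zC[OF that]
    unfolding gapC_eq by linarith
  then show "sC p c * (1 - uC p c) = 0"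
    and "uC p c * (sC p c + duR p c - (\<Sum>h\<in>subs D c. sH p h c)) = 0"
    if "c \<in> mics D"
    using that by blast+
  show "uC p c * duR p c = 0" if "c \<in> mics D"
    using that by (rule duR0)
  \<comment> \<open>The two suborder sums in \<open>gapC_eq\<close> vanish as wholes; nonnegativity
    of their summands passes this on to each \<open>h\<close>.\<close>
  show "sH p h c * (uC p c - xH p h c) = 0"
    and "xH p h c * (sH p h c + powH D h c * price p (locH D h c) (slotH D h c)
        - powH D h c * limH D h c) = 0"
    if "c \<in> mics D" "h \<in> subs D c"
    using *[OF that(1)] H1[OF that(1)] H2[OF that(1)] finite_subs[OF that(1)] that(2)
    by (simp_all only: sum_nonneg_eq_0_iff)
  show "vM p m * ((\<Sum>k\<in>netvars D. netA D m k * nK p k) - netW D m) = 0" if "m \<in> netcons D"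
    using zM[OF that] by (auto simp: gapM_def)
qed

text \<open>UMFS has one constraint per block with both multipliers. On each partition class
  \<open>umfs_gap_zero\<close> removes the multiplier of the other class, leaving the dual
  constraint of that class. Restriction is harmless, because the conditions read each multiplier
  only on its own class.\<close>

lemma umfs_project:
  assumes p: "p \<in> umfs D MJ MC"
  defines "Jr \<equiv> {j \<in> blocks D. yJ p j = 0}" and "Ja \<equiv> {j \<in> blocks D. yJ p j = 1}"
    and "Cr \<equiv> {c \<in> mics D. uC p c = 0}" and "Ca \<equiv> {c \<in> mics D. uC p c = 1}"
  defines "q \<equiv> project Jr Ja Cr Ca p"
  shows "is_partition (blocks D) Jr Ja" "is_partition (mics D) Cr Ca"
    "primal D Jr Ja Cr Ca q" "dual D Jr Ja Cr Ca q" "complementarity D Jr Ja Cr Ca q"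
proof -
  have cp: "common_primal D p" and cd: "common_dual D p"
    using p by (simp_all add: umfs_def)
  note bin = common_primal_binary[OF cp] and z = umfs_gap_zero[OF p]
  show "is_partition (blocks D) Jr Ja" "is_partition (mics D) Cr Ca"
    unfolding Jr_def Ja_def Cr_def Ca_def using bin by (auto intro!: is_partition_binary)
  have "common_primal D q"
    using cp by (simp add: q_def project_def common_primal_def balance_def)
  then show "primal D Jr Ja Cr Ca q"
    by (simp add: primal_def q_def project_def Jr_def Ja_def Cr_def Ca_def)
  have "common_dual D q"
    using cd by (simp add: q_def project_def common_dual_def)
  moreover
  have J: "dR p j \<ge> 0" "dA p j \<ge> 0"
      "sJ p j + dR p j - dA p j + (\<Sum>t\<in>slots D. powJ D j t * price p (locJ D j) t)
      \<ge> (\<Sum>t\<in>slots D. powJ D j t * limJ D j)" if "j \<in> blocks D" for j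
    using p that by (simp_all add: umfs_def)
  have C: "duR p c \<ge> 0" "duA p c = 0" "sC p c + duR p c \<ge> (\<Sum>h\<in>subs D c. sH p h c)"
    if "c \<in> mics D" for c
    using p that by (simp_all add: umfs_def)
  \<comment> \<open>With \<open>yJ p j = 0\<close>, \<open>z(3)\<close> reads
    \<open>dA p j = 0\<close>; likewise \<open>z(4)\<close> removes \<open>dR\<close> on
    \<open>Ja\<close> and \<open>z(7)\<close> removes \<open>duR\<close> on \<open>Ca\<close>
    below.\<close>
  moreover have "dR p j \<ge> 0"
      "sJ p j + dR p j + (\<Sum>t\<in>slots D. powJ D j t * price p (locJ D j) t)
      \<ge> (\<Sum>t\<in>slots D. powJ D j t * limJ D j)" if "j \<in> Jr" for j
    using J[of j] z(3)[of j] that by (simp_all add: Jr_def)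
  moreover have "dA p j \<ge> 0"
      "sJ p j - dA p j + (\<Sum>t\<in>slots D. powJ D j t * price p (locJ D j) t)
      \<ge> (\<Sum>t\<in>slots D. powJ D j t * limJ D j)" if "j \<in> Ja" for j
    using J[of j] z(4)[of j] that by (simp_all add: Ja_def)
  moreover have "duR p c \<ge> 0" "sC p c + duR p c \<ge> (\<Sum>h\<in>subs D c. sH p h c)" if "c \<in> Cr" for c
    using C[of c] that by (simp_all add: Cr_def)
  moreover have "duA p c \<ge> 0" "sC p c - duA p c \<ge> (\<Sum>h\<in>subs D c. sH p h c)" if "c \<in> Ca" for c
    using C[of c] z(7)[of c] that by (simp_all add: Ca_def)
  ultimately show "dual D Jr Ja Cr Ca q"
    by (simp add: dual_def q_def project_def)
  have "sJ p j - dA p j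
      + (\<Sum>t\<in>slots D. powJ D j t * (price p (locJ D j) t - limJ D j)) = 0" if "j \<in> Ja" for j
    using z(4)[of j] z(6)[of j] that by (simp add: Ja_def)
  moreover have "sC p c - duA p c - (\<Sum>h\<in>subs D c. sH p h c) = 0" if "c \<in> Ca" for c
    using C[of c] z(7)[of c] z(9)[of c] that by (simp add: Ca_def)
  moreover have "yJ p j = 0" if "j \<in> Jr" for j
    using that by (simp add: Jr_def)
  moreover have "yJ p j = 1" if "j \<in> Ja" for j
    using that by (simp add: Ja_def)
  moreover have "uC p c = 0" if "c \<in> Cr" for c
    using that by (simp add: Cr_def)
  moreover have "uC p c = 1" if "c \<in> Ca" for c
    using that by (simp add: Ca_def)
  \<comment> \<open>On \<open>Jr\<close> and \<open>Cr\<close> the factors \<open>yJ\<close> and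
    \<open>uC\<close> are 0. Deleting \<open>mult_eq_0_iff\<close> keeps the products intact, so
    that the facts from \<open>z\<close> match them.\<close>
  ultimately show "complementarity D Jr Ja Cr Ca q"
    unfolding complementarity_def q_def project_def
    using z(1,2,5,8,10-12) by (simp del: mult_eq_0_iff)
qed

section \<open>Lifting to UMFS\<close>

text \<open>The given multipliers may exceed the big-M bounds: for a rejected bid \<open>dR\<close>,
  or \<open>sH\<close> together with \<open>duR\<close>, can be enlarged freely, and for an accepted
  block complementarity fixes only \<open>sJ - dA\<close>. Hence the change of multipliers.\<close>

lemma umfs_lift:
  assumes part: "is_partition (blocks D) Jr Ja" "is_partition (mics D) Cr Ca"
    and pr: "primal D Jr Ja Cr Ca p" and du: "dual D Jr Ja Cr Ca p"
    and co: "complementarity D Jr Ja Cr Ca p" and range: "price_range D pibar p"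
  shows "\<exists>sI' sJ' sH' sC' dA' dR' duA' duR'.
    p\<lparr>sI := sI', sJ := sJ', sH := sH', sC := sC',
      dA := dA', dR := dR', duA := duA', duR := duR'\<rparr> \<in> umfs D MJ MC"
proof -
  \<comment> \<open>\<open>W j\<close> is the loss of block \<open>j\<close> at full execution, so
    \<open>- W j\<close> is its surplus; \<open>S h c\<close> is the positive part of the surplus of
    a suborder.\<close>
  define W where "W j = (\<Sum>t\<in>slots D. powJ D j t * (price p (locJ D j) t - limJ D j))" for j
  define S where "S h c = max 0 (powH D h c * limH D h c
      - powH D h c * price p (locH D h c) (slotH D h c))" for h c
  \<comment> \<open>An accepted block splits \<open>- W j\<close> into positive part
    \<open>sJ'\<close> and negative part \<open>dA'\<close>; a rejected block books its positive
    part as \<open>dR'\<close>.\<close>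
  define sJ' where "sJ' j = (if j \<in> Jr then 0 else max 0 (- W j))" for j
  define dA' where "dA' j = (if j \<in> Jr then 0 else max 0 (W j))" for j
  define dR' where "dR' j = (if j \<in> Jr then max 0 (- W j) else 0)" for j
  define sH' where "sH' h c = (if c \<in> Cr then S h c else sH p h c)" for h c
  \<comment> \<open>For an accepted MIC bid, complementarity gives \<open>sC - duA\<close> equal to
    the sum of \<open>sH\<close>. Taking this sum as \<open>sC'\<close> absorbs \<open>duA\<close>,
    which UMFS requires to be 0.\<close>
  define sC' where "sC' c = (if c \<in> Cr then 0 else (\<Sum>h\<in>subs D c. sH p h c))" for c
  define duR' where "duR' c = (if c \<in> Cr then (\<Sum>h\<in>subs D c. S h c) else 0)" for c
  \<comment> \<open>\<open>sI\<close> keeps its value, but is written as an update so that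
    \<open>q\<close> has the shape demanded by the existential statement.\<close>
  define q where "q = p\<lparr>sI := sI p, sJ := sJ', sH := sH', sC := sC',
      dA := dA', dR := dR', duA := \<lambda>_. 0, duR := duR'\<rparr>"
  note defs = sJ'_def dA'_def dR'_def sH'_def sC'_def duR'_def
  have q_simps [simp]: "xI q = xI p" "xH q = xH p" "yJ q = yJ p" "uC q = uC p" "nK q = nK p"
      "price q = price p" "vM q = vM p" "sI q = sI p" "sJ q = sJ'" "sH q = sH'" "sC q = sC'"
      "dA q = dA'" "dR q = dR'" "duA q = (\<lambda>_. 0)" "duR q = duR'"
    by (simp_all add: q_def)
  have cpp: "common_primal D p" and cdp: "common_dual D p"
    using pr du by (simp_all add: primal_def dual_def)
  have y: "yJ p j = (if j \<in> Jr then 0 else 1)" if "j \<in> blocks D" for j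
    using pr part(1) that unfolding primal_def common_primal_def is_partition_def
    by (smt (verit, best) Un_iff)
  have u: "uC p c = (if c \<in> Cr then 0 else 1)" if "c \<in> mics D" for c
    using pr part(2) that unfolding primal_def common_primal_def is_partition_def
    by (smt (verit, best) Un_iff)
  have W: "\<bar>W j\<bar> \<le> MJ j" if "j \<in> blocks D" for j
    unfolding W_def using that range by (rule surplusJ_bound)
  have S: "(\<Sum>h\<in>subs D c. S h c) \<le> MC c" if "c \<in> mics D" for c
    unfolding S_def using that range by (rule surplusH_bound)
  have S_nonneg: "S h c \<ge> 0"
      "S h c + powH D h c * price p (locH D h c) (slotH D h c) \<ge> powH D h c * limH D h c" for h c
    by (simp_all add: S_def max_def)
  have cp: "common_primal D q"
    using cpp by (simp add: common_primal_def balance_def)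
  have "sH' h c \<ge> 0 \<and>
      sH' h c + powH D h c * price p (locH D h c) (slotH D h c) \<ge> powH D h c * limH D h c"
    if "c \<in> mics D" "h \<in> subs D c" for h c
    using cdp that S_nonneg by (simp add: sH'_def common_dual_def)
  moreover have "sC' c \<ge> 0" if "c \<in> mics D" for c
    using cdp that by (simp add: sC'_def common_dual_def sum_nonneg)
  moreover have "sJ' j \<ge> 0" for j
    by (simp add: sJ'_def)
  ultimately have cd: "common_dual D q"
    using cdp by (simp add: common_dual_def)
  have "gapI D q i = 0" if "i \<in> hourly D" for i
  proof -
    have "sI p i * (1 - xI p i) = 0"
        "xI p i * (sI p i + powI D i * price p (locI D i) (slotI D i) - powI D i * limI D i) = 0"
      using co that unfolding complementarity_def by blast+
    then show ?thesis unfolding gapI_eq q_simps by linarith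
  qed
  \<comment> \<open>If rejected, all terms are 0; if accepted,
    \<open>max 0 (- W j) - max 0 (W j) + W j = 0\<close>.\<close>
  moreover have "gapJ D q j = 0" if "j \<in> blocks D" for j
    using y[OF that] by (auto simp: gapJ_def defs W_def[symmetric])
  moreover have "gapC D q c = 0" if "c \<in> mics D" for c
  proof (cases "c \<in> Cr")
    case True
    \<comment> \<open>A rejected MIC bid squeezes its suborders:
      \<open>0 \<le> xH p h c \<le> uC p c = 0\<close>.\<close>
    have "xH p h c = 0" if "h \<in> subs D c" for h
      using cpp u[OF \<open>c \<in> mics D\<close>] \<open>c \<in> mics D\<close> that True
      by (force simp: common_primal_def intro: antisym)
    then show ?thesis by (simp add: gapC_def defs True)
  next
    case False
    have "sH p h c * (uC p c - xH p h c) = 0"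
        "xH p h c * (sH p h c + powH D h c * price p (locH D h c) (slotH D h c)
          - powH D h c * limH D h c) = 0" if "h \<in> subs D c" for h
      using co \<open>c \<in> mics D\<close> that by (simp_all add: complementarity_def)
    \<comment> \<open>With \<open>uC p c = 1\<close>, \<open>duR' c = 0\<close> and
      \<open>sC' c\<close> the sum of \<open>sH\<close>, only the suborder products of the original
      point survive in \<open>gapC_eq\<close>.\<close>
    then show ?thesis
      using False u[OF that] unfolding gapC_eq by (simp add: defs del: mult_eq_0_iff)
  qed
  moreover have "gapM D q m = 0" if "m \<in> netcons D" for m
    using co that by (auto simp: gapM_def complementarity_def)
  \<comment> \<open>A zero gap gives equality of the two objectives, hence the required
    inequality.\<close>
  ultimately have "(\<Sum>i\<in>hourly D. limI D i * powI D i * xI q i)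
      + (\<Sum>c\<in>mics D. \<Sum>h\<in>subs D c. limH D h c * powH D h c * xH q h c)
      + (\<Sum>j\<in>blocks D. \<Sum>t\<in>slots D. limJ D j * powJ D j t * yJ q j)
    \<ge> (\<Sum>i\<in>hourly D. sI q i) + (\<Sum>j\<in>blocks D. sJ q j) + (\<Sum>c\<in>mics D. sC q c)
      - (\<Sum>j\<in>blocks D. dA q j) + (\<Sum>m\<in>netcons D. netW D m * vM q m)"
    using duality_gap[OF cp cd] by simp
  moreover have "sJ' j + dR' j - dA' j + (\<Sum>t\<in>slots D. powJ D j t * price p (locJ D j) t)
      \<ge> (\<Sum>t\<in>slots D. powJ D j t * limJ D j)" for j
  proof -
    have "sJ' j + dR' j - dA' j + W j \<ge> 0" by (simp add: defs max_def)
    then show ?thesis by (simp add: W_def right_diff_distrib sum_subtractf)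
  qed
  moreover have "sC' c + duR' c \<ge> (\<Sum>h\<in>subs D c. sH' h c)" for c
    by (simp add: defs)
  moreover have "dR' j \<le> MJ j * (1 - yJ p j)" "dA' j \<le> MJ j * yJ p j" if "j \<in> blocks D" for j
    using W[OF that] y[OF that] by (auto simp: defs)
  moreover have "duR' c \<le> MC c * (1 - uC p c)" if "c \<in> mics D" for c
    using S[OF that] u[OF that] by (auto simp: defs)
  moreover have "dA' j \<ge> 0" "dR' j \<ge> 0" for j
    by (simp_all add: defs)
  moreover have "duR' c \<ge> 0" for c
    by (simp add: defs S_nonneg sum_nonneg)
  ultimately have "q \<in> umfs D MJ MC"
    using cp cd by (simp add: umfs_def)
  then show ?thesis unfolding q_def by blast
qed

end

theorem theorem1:
  fixes D :: "('i, 'j, 'c, 'h, 'l, 't, 'm, 'k) market"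
    and pibar :: real
    and MJ :: "'j \<Rightarrow> real"
    and MC :: "'c \<Rightarrow> real"
  assumes "power_market D pibar MJ MC"
  shows
    "(\<forall>p \<in> umfs D MJ MC. price_range D pibar p \<longrightarrow>
       (let Jr = {j \<in> blocks D. yJ p j = 0};
            Ja = {j \<in> blocks D. yJ p j = 1};
            Cr = {c \<in> mics D. uC p c = 0};
            Ca = {c \<in> mics D. uC p c = 1};
            q = project Jr Ja Cr Ca p
        in is_partition (blocks D) Jr Ja \<and> is_partition (mics D) Cr Ca \<and>
           primal D Jr Ja Cr Ca q \<and> dual D Jr Ja Cr Ca q \<and> complementarity D Jr Ja Cr Ca q))
     \<and>
     (\<forall>Jr Ja Cr Ca p.
        is_partition (blocks D) Jr Ja \<and> is_partition (mics D) Cr Ca \<and>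
        primal D Jr Ja Cr Ca p \<and> dual D Jr Ja Cr Ca p \<and> complementarity D Jr Ja Cr Ca p \<and>
        price_range D pibar p \<longrightarrow>
        (\<exists>sI' sJ' sH' sC' dA' dR' duA' duR'.
           p\<lparr>sI := sI', sJ := sJ', sH := sH', sC := sC',
             dA := dA', dR := dR', duA := duA', duR := duR'\<rparr> \<in> umfs D MJ MC))"
proof -
  interpret power_market D pibar MJ MC by fact
  show ?thesis
    unfolding Let_def
    by (rule conjI; intro allI ballI impI; (elim conjE)?)
      (intro conjI umfs_project umfs_lift; assumption)+
qed

end
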